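(* Let $r\ge 0$ and $m\ge r+1$, and let $\boldsymbol{G}$ be the standard generator matrix of the binary Reed--Muller code $\mathrm{RM}(r,m)$, of dimension $k$. Let $s_i$ and $s_j$ ($i,j\in[k]$) be two message symbols of orders $\ell_1$ and $\ell_2$, respectively, with $0\le \ell_1<\ell_2\le r$. Then every $\boldsymbol{\lambda}=(\lambda_1,\dots,\lambda_k)\in\mathcal{S}(\boldsymbol{G})$ satisfies $$\lambda_i+\lambda_j\le 1+\frac{2^m-2^{\ell_2}}{2^{r+1}-2^{\ell_2}}.$$
   Context: Notation: $[a]=\{1,\dots,a\}$; $\boldsymbol{e}_i$ is the $i$-th unit vector of length $k$. Reed--Muller code and generator matrix. For $0\le r\le m$, the binary code $\mathrm{RM}(r,m)$ consists of the evaluation vectors, over all $2^m$ points of $\mathbb{F}_2^m$, of the polynomials of degree at most $r$ in $m$ binary variables $v_1,\dots,v_m$. It has length $n=2^m$ and dimension $k=\sum_{i=0}^r\binom{m}{i}$. Its standard generator matrix $\boldsymbol{G}\in\mathbb{F}_2^{k\times n}$ has one row for each monomial $\prod_{t\in T}v_t$ with $T\subseteq[m]$, $|T|\le r$ (ordered by increasing degree and, within each degree, in reverse lexicographic order of the variable indices), and one column for each point of $\mathbb{F}_2^m$ (in lexicographic order); each entry is the value of the monomial at the point. Recovery sets. The $k$ message symbols $s_1,\dots,s_k$ correspond to the $k$ rows of $\boldsymbol{G}$, and the $n$ servers correspond to its columns $\boldsymbol{g}_1,\dots,\boldsymbol{g}_n$. A message symbol has order $\ell$ if its row is indexed by a monomial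 of degree $\ell$. A set $R\subseteq[n]$ is a recovery set for $s_i$ if $\boldsymbol{e}_i$ is an $\mathbb{F}_2$-linear combination of the columns $\{\boldsymbol{g}_j: j\in R\}$ and no proper subset of $R$ has this property (i.e., recovery sets are taken to be minimal). Let $R_{i,1},\dots,R_{i,t_i}$ be all the recovery sets for $s_i$. Service rate region. All servers have capacity $1$. $\mathcal{S}(\boldsymbol{G})\subseteq\mathbb{R}_{\ge0}^k$ is the set of all $\boldsymbol{\lambda}=(\lambda_1,\dots,\lambda_k)\in\mathbb{R}_{\ge 0}^k$ for which there exist $\lambda_{i,j}\in\mathbb{R}_{\ge0}$ ($i\in[k]$, $j\in[t_i]$) with $\sum_{j=1}^{t_i}\lambda_{i,j}=\lambda_i$ for all $i\in[k]$, and $\sum_{i=1}^k\sum_{j\in[t_i]:\,\ell\in R_{i,j}}\lambda_{i,j}\le 1$ for all $\ell\in[n]$. *)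

theory Defs
  imports
    "Jordan_Normal_Form.VS_Connect"
    "HOL-Library.Z2"
    "HOL-Library.List_Lexorder"
begin

section \<open>The standard generator matrix of a binary Reed--Muller code\<close>

text \<open>
  The field with two elements is \<^typ>\<open>bit\<close>. The monomial given by \<open>T \<subseteq> {1..m}\<close> is represented by
  the strictly increasing list of its variable indices, so that the lexicographic order on index
  lists is the one on \<^typ>\<open>nat list\<close>. Rows and columns of matrices are indexed from 0.
\<close>

definition monomials_of_degree :: "nat \<Rightarrow> nat \<Rightarrow> nat list set" where
  "monomials_of_degree m d = {T. sorted_wrt (<) T \<and> set T \<subseteq> {1..m} \<and> length T = d}"

definition rm_monomials :: "nat \<Rightarrow> nat \<Rightarrow> nat list list" where
  "rm_monomials r m = concat (map (\<lambda>d. rev (sorted_list_of_set (monomials_of_degree m d))) [0..<Suc r])"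

text \<open>
  \<^const>\<open>product_lists\<close> lets the last coordinate vary fastest, so this lists the points
  \<open>(v\<^sub>1, \<dots>, v\<^sub>m)\<close> in lexicographic order with \<open>0 < 1\<close>.
\<close>

definition rm_points :: "nat \<Rightarrow> bit list list" where
  "rm_points m = product_lists (replicate m [0, 1])"

text \<open>The variable \<open>v\<^sub>t\<close> takes the value \<open>p ! (t - 1)\<close> at the point \<open>p\<close>.\<close>

definition monomial_value :: "nat list \<Rightarrow> bit list \<Rightarrow> bit" where
  "monomial_value T p = (\<Prod>t\<in>set T. p ! (t - 1))"

definition rm_dim :: "nat \<Rightarrow> nat \<Rightarrow> nat" where
  "rm_dim r m = (\<Sum>d\<le>r. m choose d)"

definition rm_generator :: "nat \<Rightarrow> nat \<Rightarrow> bit mat" where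
  "rm_generator r m =
     mat (rm_dim r m) (2 ^ m) (\<lambda>(i, j). monomial_value (rm_monomials r m ! i) (rm_points m ! j))"

definition symbol_order :: "nat \<Rightarrow> nat \<Rightarrow> nat \<Rightarrow> nat" where
  "symbol_order r m i = length (rm_monomials r m ! i)"

text \<open>
  The list indices used in \<^const>\<open>rm_generator\<close> are in range: there are exactly \<^term>\<open>rm_dim r m\<close>
  monomials, without repetitions, and \<^term>\<open>2 ^ m\<close> points.
\<close>

lemma bij_betw_monomials_of_degree:
  "bij_betw set (monomials_of_degree m d) {T. T \<subseteq> {1..m} \<and> card T = d}"
proof (rule bij_betwI[where g = sorted_list_of_set])
  show "set \<in> monomials_of_degree m d \<rightarrow> {T. T \<subseteq> {1..m} \<and> card T = d}"
    by (auto simp: monomials_of_degree_def strict_sorted_iff distinct_card)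
  show "sorted_list_of_set \<in> {T. T \<subseteq> {1..m} \<and> card T = d} \<rightarrow> monomials_of_degree m d"
    using finite_subset[OF _ finite_atLeastAtMost[of 1 m]] by (fastforce simp: monomials_of_degree_def)
  show "sorted_list_of_set (set T) = T" if "T \<in> monomials_of_degree m d" for T
    using that by (auto simp: monomials_of_degree_def strict_sorted_iff sorted_list_of_set.idem_if_sorted_distinct)
  show "set (sorted_list_of_set T) = T" if "T \<in> {T. T \<subseteq> {1..m} \<and> card T = d}" for T
    using that finite_subset[OF _ finite_atLeastAtMost[of 1 m]] by simp
qed

lemma card_monomials_of_degree: "card (monomials_of_degree m d) = m choose d"
  using bij_betw_same_card[OF bij_betw_monomials_of_degree] n_subsets[of "{1..m}" d] by simp

lemma finite_monomials_of_degree: "finite (monomials_of_degree m d)"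
  using bij_betw_finite[OF bij_betw_monomials_of_degree, of m d] by simp

lemma length_rm_monomials: "length (rm_monomials r m) = rm_dim r m"
proof -
  have "length (rm_monomials r m) = (\<Sum>d\<leftarrow>[0..<Suc r]. m choose d)"
    by (simp add: rm_monomials_def length_concat comp_def card_monomials_of_degree del: upt_Suc)
  also have "\<dots> = (\<Sum>d\<le>r. m choose d)"
    by (simp only: interv_sum_list_conv_sum_set_nat atLeast0LessThan lessThan_Suc_atMost set_upt)
  finally show ?thesis
    by (simp only: rm_dim_def)
qed

lemma set_rm_monomials: "set (rm_monomials r m) = (\<Union>d\<le>r. monomials_of_degree m d)"
  by (auto simp: rm_monomials_def finite_monomials_of_degree less_Suc_eq_le simp del: upt_Suc)

lemma distinct_rm_monomials: "distinct (rm_monomials r m)"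
proof (rule card_distinct)
  have "card (\<Union>d\<le>r. monomials_of_degree m d) = (\<Sum>d\<le>r. card (monomials_of_degree m d))"
    by (rule card_UN_disjoint) (auto simp: finite_monomials_of_degree, auto simp: monomials_of_degree_def)
  then show "card (set (rm_monomials r m)) = length (rm_monomials r m)"
    by (simp only: set_rm_monomials length_rm_monomials rm_dim_def card_monomials_of_degree)
qed

lemma set_rm_points: "set (rm_points m) = {p. length p = m}"
proof -
  have "x \<in> {0, 1}" for x :: bit
    by (cases x) simp_all
  then show ?thesis
    by (auto simp: rm_points_def product_lists_set list_all2_conv_all_nth)
qed

lemma length_rm_points: "length (rm_points m) = 2 ^ m"
  unfolding rm_points_def by (induction m) simp_all

lemma distinct_rm_points: "distinct (rm_points m)"
  unfolding rm_points_def by (rule distinct_product_lists) auto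


section \<open>Recovery sets and the service rate region\<close>

definition recovers :: "bit mat \<Rightarrow> nat \<Rightarrow> nat set \<Rightarrow> bool" where
  "recovers G i R \<longleftrightarrow>
     unit_vec (dim_row G) i
       \<in> LinearCombinations.module.span class_ring (module_vec TYPE(bit) (dim_row G)) (col G ` R)"

definition recovery_sets :: "bit mat \<Rightarrow> nat \<Rightarrow> nat set set" where
  "recovery_sets G i =
     {R. R \<subseteq> {..<dim_col G} \<and> recovers G i R \<and> (\<forall>R'. R' \<subset> R \<longrightarrow> \<not> recovers G i R')}"

text \<open>
  The part of the request rate for symbol \<open>i\<close> that is assigned to a recovery set \<open>R\<close> is \<open>\<mu> i R\<close>,
  indexed by the recovery set itself rather than by its position in an enumeration.
\<close>

definition service_rate_region :: "bit mat \<Rightarrow> real vec set" where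
  "service_rate_region G =
     {rate \<in> carrier_vec (dim_row G).
        (\<forall>i<dim_row G. 0 \<le> rate $ i) \<and>
        (\<exists>\<mu> :: nat \<Rightarrow> nat set \<Rightarrow> real.
           (\<forall>i<dim_row G. \<forall>R\<in>recovery_sets G i. 0 \<le> \<mu> i R) \<and>
           (\<forall>i<dim_row G. (\<Sum>R\<in>recovery_sets G i. \<mu> i R) = rate $ i) \<and>
           (\<forall>s<dim_col G. (\<Sum>i<dim_row G. \<Sum>R\<in>{R \<in> recovery_sets G i. s \<in> R}. \<mu> i R) \<le> 1))}"

end

theory Submission
  imports Defs
begin

text \<open>
  Identify a server with the support \<open>P \<subseteq> {1..m}\<close> of its point, so that a monomial \<open>S\<close> is 1 there
  iff \<open>S \<subseteq> P\<close>. The recovery sets of the monomial \<open>T\<close> and the cube \<open>Pow T\<close> have the same parities of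
  \<open>{P. S \<subseteq> P}\<close> for \<open>card S \<le> r\<close>, so a recovery set other than \<open>Pow T\<close> differs from it in a nonzero word
  of the dual code, that is, in at least \<open>2 ^ (r + 1)\<close> places. Now use LP duality: put \<open>D = 2 ^ (r + 1) - 2 ^ l2\<close>,
  let \<open>Z \<subseteq> Pow Tj - Pow Ti\<close> have \<open>2 ^ l2 - 2 ^ l1\<close> elements, and give the servers in \<open>Z\<close> weight 0, the
  others weight \<open>1 / D\<close>, and the origin an additional \<open>1 - 2 ^ l1 / D\<close>. Every recovery set of either symbol
  has weight at least 1, and the total weight is the claimed bound.
\<close>

section \<open>Set families with even degrees\<close>

text \<open>This is the minimum distance \<open>2 ^ d\<close> of the dual of \<open>RM(d - 1, m)\<close>.\<close>

lemma card_ge_power2_of_even_degrees: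
  fixes A :: "'a set set"
  assumes "finite A" "A \<noteq> {}"
    and "\<And>S. finite S \<Longrightarrow> card S < d \<Longrightarrow> even (card {P \<in> A. S \<subseteq> P})"
  shows "2 ^ d \<le> card A"
  using assms
proof (induction d arbitrary: A)
  case 0
  then show ?case by (simp add: Suc_leI card_gt_0_iff)
next
  case (Suc d)
  \<comment> \<open>The choice \<open>S = {}\<close> excludes a single member, so \<open>A\<close>
    has two members, and some \<open>x\<close> lies in exactly one of them. Splitting
    \<open>A\<close> at \<open>x\<close> then gives two nonempty halves.\<close>
  have "even (card A)" using Suc.prems(3)[of "{}"] by simp
  then have "card A \<noteq> 1" by auto
  then have "\<exists>P\<in>A. \<exists>Q\<in>A. P \<noteq> Q"
    using Suc.prems(2) by (metis is_singletonI' is_singleton_altdef)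
  then obtain P Q x where x: "P \<in> A" "Q \<in> A" "x \<in> P" "x \<notin> Q" by blast
  define A1 A0 where "A1 = {P \<in> A. x \<in> P}" and "A0 = {P \<in> A. x \<notin> P}"
  have fin: "finite A1" "finite A0" using Suc.prems(1) by (auto simp: A1_def A0_def)
  \<comment> \<open>Supersets of \<open>S\<close> in \<open>A1\<close> are the supersets of
    \<open>insert x S\<close> in \<open>A\<close>; the extra element accounts for the drop from
    \<open>Suc d\<close> to \<open>d\<close>.\<close>
  have even1: "even (card {P \<in> A1. S \<subseteq> P})" if "finite S" "card S < d" for S
  proof -
    have "card (insert x S) < Suc d" using that by (simp add: card_insert_if)
    then have "even (card {P \<in> A. insert x S \<subseteq> P})" using Suc.prems(3) that by blast
    moreover have "{P \<in> A. insert x S \<subseteq> P} = {P \<in> A1. S \<subseteq> P}" by (auto simp: A1_def)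
    ultimately show ?thesis by simp
  qed
  have even0: "even (card {P \<in> A0. S \<subseteq> P})" if "finite S" "card S < d" for S
  proof -
    have "{P \<in> A. S \<subseteq> P} = {P \<in> A1. S \<subseteq> P} \<union> {P \<in> A0. S \<subseteq> P}" by (auto simp: A1_def A0_def)
    moreover have "{P \<in> A1. S \<subseteq> P} \<inter> {P \<in> A0. S \<subseteq> P} = {}" by (auto simp: A1_def A0_def)
    ultimately have "card {P \<in> A. S \<subseteq> P} = card {P \<in> A1. S \<subseteq> P} + card {P \<in> A0. S \<subseteq> P}"
      using fin by (simp add: card_Un_disjoint)
    then show ?thesis using even1[OF that] Suc.prems(3)[of S] that by simp
  qed
  have "2 ^ d \<le> card A1"
    using Suc.IH[OF fin(1) _ even1] x by (auto simp: A1_def)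
  moreover have "2 ^ d \<le> card A0"
    using Suc.IH[OF fin(2) _ even0] x by (auto simp: A0_def)
  moreover have "card A = card A1 + card A0"
  proof -
    have "A = A1 \<union> A0" "A1 \<inter> A0 = {}" by (auto simp: A1_def A0_def)
    then show ?thesis using fin by (metis card_Un_disjoint)
  qed
  ultimately show ?case by simp
qed

lemma even_card_sym_diff:
  assumes "finite A" "finite B"
  shows "even (card (sym_diff A B)) \<longleftrightarrow> (even (card A) \<longleftrightarrow> even (card B))"
proof -
  have "card (sym_diff A B) = card (A - B) + card (B - A)"
    using assms by (intro card_Un_disjoint) auto
  moreover have "card A = card (A - B) + card (A \<inter> B)"
    using assms by (metis card_Int_Diff add.commute)
  moreover have "card B = card (B - A) + card (A \<inter> B)"
    using assms by (metis card_Int_Diff add.commute Int_commute)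
  ultimately show ?thesis by auto
qed

text \<open>The sets between \<open>S\<close> and \<open>T\<close> correspond to the subsets of
  \<open>T - S\<close>, and a power of 2 is odd only when its exponent is 0.\<close>

lemma odd_card_supersets_in_Pow:
  assumes "finite T"
  shows "odd (card {P \<in> Pow T. S \<subseteq> P}) \<longleftrightarrow> S = T"
proof (cases "S \<subseteq> T")
  case True
  have "bij_betw (\<lambda>P. P \<union> S) (Pow (T - S)) {P \<in> Pow T. S \<subseteq> P}"
    using True by (intro bij_betwI[where g = "\<lambda>P. P - S"]) auto
  then have "card {P \<in> Pow T. S \<subseteq> P} = 2 ^ card (T - S)"
    using assms by (metis bij_betw_same_card card_Pow finite_Diff)
  moreover have "card (T - S) = 0 \<longleftrightarrow> S = T"
    using assms True by auto
  ultimately show ?thesis by simp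
next
  case False
  then have "{P \<in> Pow T. S \<subseteq> P} = {}" by auto
  moreover have "S \<noteq> T" using False by auto
  ultimately show ?thesis by (metis card.empty even_zero)
qed

text \<open>Parities add under symmetric difference, and \<open>Pow T\<close> has the parities
  assumed of \<open>F\<close>. They cancel for all \<open>S\<close> with at most \<open>r\<close>
  elements, so the distance bound applies with \<open>d = r + 1\<close>.\<close>

lemma card_sym_diff_Pow_ge:
  assumes "finite F" "finite T" "F \<noteq> Pow T"
    and "\<And>S. finite S \<Longrightarrow> card S \<le> r \<Longrightarrow> odd (card {P \<in> F. S \<subseteq> P}) \<longleftrightarrow> S = T"
  shows "2 ^ (r + 1) \<le> card (sym_diff F (Pow T))"
proof (rule card_ge_power2_of_even_degrees)
  show "finite (sym_diff F (Pow T))" "sym_diff F (Pow T) \<noteq> {}" using assms by auto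
next
  fix S :: "'a set"
  assume S: "finite S" "card S < r + 1"
  have eq: "{P \<in> sym_diff F (Pow T). S \<subseteq> P} = sym_diff {P \<in> F. S \<subseteq> P} {P \<in> Pow T. S \<subseteq> P}" by auto
  have "odd (card {P \<in> F. S \<subseteq> P}) \<longleftrightarrow> odd (card {P \<in> Pow T. S \<subseteq> P})"
    using assms(4)[OF S(1)] S(2) odd_card_supersets_in_Pow[OF assms(2), of S] by simp
  moreover have "finite {P \<in> F. S \<subseteq> P}" "finite {P \<in> Pow T. S \<subseteq> P}" using assms(1,2) by simp_all
  ultimately show "even (card {P \<in> sym_diff F (Pow T). S \<subseteq> P})"
    unfolding eq by (subst even_card_sym_diff) blast+
qed

section \<open>Recovery sets\<close>

text \<open>A combination over the field with two elements is a subset sum. The servers in that sum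
  already recover symbol \<open>i\<close>, so by minimality they are all of
  \<open>R\<close>.\<close>

lemma sum_recovery_set:
  assumes R: "R \<in> recovery_sets G i" and i: "i < dim_row G" and k: "k < dim_row G"
  shows "(\<Sum>s\<in>R. G $$ (k, s)) = (if k = i then 1 else 0)"
proof -
  interpret vec_space "TYPE(bit)" "dim_row G" .
  have sub: "R \<subseteq> {..<dim_col G}" and rec: "recovers G i R"
    and min: "\<And>R'. R' \<subset> R \<Longrightarrow> \<not> recovers G i R'"
    using R by (auto simp: recovery_sets_def)
  have fin: "finite R" using sub finite_subset by blast
  have car: "col G ` R \<subseteq> carrier_vec (dim_row G)" by auto
  obtain a where a: "lincomb a (col G ` R) = unit_vec (dim_row G) i"
    using finite_in_span[of "col G ` R" "unit_vec (dim_row G) i"] fin car rec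
    unfolding recovers_def by auto
  define C where "C = {v \<in> col G ` R. a v = 1}"
  have "C \<subseteq> col G ` R" by (auto simp: C_def)
  \<comment> \<open>The span is that of a set of columns, in which equal columns coincide;
    \<open>R'\<close> picks one server for each column with coefficient 1.\<close>
  then obtain R' where R': "R' \<subseteq> R" "inj_on (col G) R'" "C = col G ` R'"
    by (metis subset_image_inj)
  have eq: "(\<Sum>s\<in>R'. G $$ (l, s)) = unit_vec (dim_row G) i $ l" if l: "l < dim_row G" for l
  proof -
    have "unit_vec (dim_row G) i $ l = (\<Sum>v\<in>col G ` R. a v * v $ l)"
      using lincomb_index[OF l car, of a] a by simp
    also have "\<dots> = (\<Sum>v\<in>C. v $ l)"
      using fin by (intro sum.mono_neutral_cong_right) (auto simp: C_def)
    also have "\<dots> = (\<Sum>s\<in>R'. col G s $ l)"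
      using R' by (simp add: sum.reindex)
    also have "\<dots> = (\<Sum>s\<in>R'. G $$ (l, s))"
      using R' sub l by (intro sum.cong) auto
    finally show ?thesis by simp
  qed
  have "unit_vec (dim_row G) i = lincomb (\<lambda>_. 1) C"
  proof (rule eq_vecI)
    have Cc: "C \<subseteq> carrier_vec (dim_row G)" by (auto simp: C_def)
    have dim: "lincomb (\<lambda>_. 1) C \<in> carrier_vec (dim_row G)"
      using Cc by simp
    then show "dim_vec (unit_vec (dim_row G) i :: bit vec) = dim_vec (lincomb (\<lambda>_. 1) C)" by simp
    fix l assume "l < dim_vec (lincomb (\<lambda>_. 1) C)"
    then have l: "l < dim_row G" using dim by simp
    have "lincomb (\<lambda>_. 1) C $ l = (\<Sum>v\<in>C. v $ l)"
      by (simp only: lincomb_index[OF l Cc] mult_1_left)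
    also have "\<dots> = (\<Sum>s\<in>R'. col G s $ l)"
      using R' by (simp add: sum.reindex)
    also have "\<dots> = (\<Sum>s\<in>R'. G $$ (l, s))"
      using R' sub l by (intro sum.cong) auto
    finally show "unit_vec (dim_row G) i $ l = lincomb (\<lambda>_. 1) C $ l" using eq[OF l] by simp
  qed
  moreover have "finite C" using fin by (simp add: C_def)
  ultimately have "unit_vec (dim_row G) i \<in> span C" by (intro in_spanI) auto
  then have "recovers G i R'"
    unfolding recovers_def R'(3)[symmetric] .
  then have "R' = R" using min R'(1) by blast
  then show ?thesis using eq[OF k] k i by auto
qed

text \<open>Weak LP duality: at price \<open>w s\<close> per unit of load on server
  \<open>s\<close>, each unit of rate for a symbol in \<open>I\<close> costs at least 1, while the
  capacities cap the total cost at the sum of all prices.\<close>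

lemma service_rate_sum_le:
  assumes rate: "rate \<in> service_rate_region G"
    and I: "I \<subseteq> {..<dim_row G}"
    and w: "\<And>s. s < dim_col G \<Longrightarrow> 0 \<le> w s"
    and cover: "\<And>i R. i \<in> I \<Longrightarrow> R \<in> recovery_sets G i \<Longrightarrow> 1 \<le> (\<Sum>s\<in>R. w s)"
  shows "(\<Sum>i\<in>I. rate $ i) \<le> (\<Sum>s<dim_col G. w s)"
proof -
  obtain \<mu> :: "nat \<Rightarrow> nat set \<Rightarrow> real" where
    nonneg: "\<And>i R. i < dim_row G \<Longrightarrow> R \<in> recovery_sets G i \<Longrightarrow> 0 \<le> \<mu> i R"
    and total: "\<And>i. i < dim_row G \<Longrightarrow> (\<Sum>R\<in>recovery_sets G i. \<mu> i R) = rate $ i"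
    and capacity: "\<And>s. s < dim_col G \<Longrightarrow>
      (\<Sum>i<dim_row G. \<Sum>R\<in>{R \<in> recovery_sets G i. s \<in> R}. \<mu> i R) \<le> 1"
    using rate unfolding service_rate_region_def by blast
  have fin: "finite (recovery_sets G i)" for i
    by (rule finite_subset[of _ "Pow {..<dim_col G}"]) (auto simp: recovery_sets_def)
  have finI: "finite I" using I finite_subset by blast
  have inner: "(\<Sum>s<dim_col G. w s * (if s \<in> R then \<mu> i R else 0)) = \<mu> i R * (\<Sum>s\<in>R. w s)"
    if "R \<in> recovery_sets G i" for i R
  proof -
    have "R \<subseteq> {..<dim_col G}" using that by (simp add: recovery_sets_def)
    then have "(\<Sum>s<dim_col G. w s * (if s \<in> R then \<mu> i R else 0)) = (\<Sum>s\<in>R. w s * \<mu> i R)"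
      by (intro sum.mono_neutral_cong_right) auto
    then show ?thesis by (simp add: sum_distrib_right mult.commute)
  qed
  have "(\<Sum>i\<in>I. rate $ i) = (\<Sum>i\<in>I. \<Sum>R\<in>recovery_sets G i. \<mu> i R)"
    using I total by (intro sum.cong) auto
  also have "\<dots> \<le> (\<Sum>i\<in>I. \<Sum>R\<in>recovery_sets G i. \<mu> i R * (\<Sum>s\<in>R. w s))"
  proof (intro sum_mono)
    fix i R assume "i \<in> I" "R \<in> recovery_sets G i"
    then show "\<mu> i R \<le> \<mu> i R * (\<Sum>s\<in>R. w s)"
      using I nonneg[of i R] cover[of i R] mult_left_mono[of 1 "\<Sum>s\<in>R. w s" "\<mu> i R"] by auto
  qed
  also have "\<dots> = (\<Sum>s<dim_col G. w s * (\<Sum>i\<in>I. \<Sum>R\<in>recovery_sets G i. if s \<in> R then \<mu> i R else 0))"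
  proof -
    have "(\<Sum>i\<in>I. \<Sum>R\<in>recovery_sets G i. \<mu> i R * (\<Sum>s\<in>R. w s))
        = (\<Sum>i\<in>I. \<Sum>R\<in>recovery_sets G i. \<Sum>s<dim_col G. w s * (if s \<in> R then \<mu> i R else 0))"
      by (intro sum.cong refl) (simp only: inner)
    also have "\<dots> = (\<Sum>i\<in>I. \<Sum>s<dim_col G. \<Sum>R\<in>recovery_sets G i. w s * (if s \<in> R then \<mu> i R else 0))"
      by (intro sum.cong refl sum.swap)
    also have "\<dots> = (\<Sum>s<dim_col G. \<Sum>i\<in>I. \<Sum>R\<in>recovery_sets G i. w s * (if s \<in> R then \<mu> i R else 0))"
      by (rule sum.swap)
    finally show ?thesis by (simp only: sum_distrib_left)
  qed
  also have "\<dots> \<le> (\<Sum>s<dim_col G. w s * 1)"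
  proof (intro sum_mono mult_left_mono)
    fix s assume s: "s \<in> {..<dim_col G}"
    \<comment> \<open>Symbols outside \<open>I\<close> add nonnegative load, which leads to the full
      capacity constraint of server \<open>s\<close>.\<close>
    have "(\<Sum>i\<in>I. \<Sum>R\<in>recovery_sets G i. if s \<in> R then \<mu> i R else 0)
        \<le> (\<Sum>i<dim_row G. \<Sum>R\<in>recovery_sets G i. if s \<in> R then \<mu> i R else 0)"
      using I nonneg by (intro sum_mono2) (auto intro!: sum_nonneg)
    also have "\<dots> = (\<Sum>i<dim_row G. \<Sum>R\<in>{R \<in> recovery_sets G i. s \<in> R}. \<mu> i R)"
      using fin by (simp add: sum.inter_filter)
    also have "\<dots> \<le> 1" using capacity s by simp
    finally show "(\<Sum>i\<in>I. \<Sum>R\<in>recovery_sets G i. if s \<in> R then \<mu> i R else 0) \<le> 1" .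
  qed (use w in auto)
  finally show ?thesis by simp
qed

section \<open>Reed--Muller codes\<close>

definition point_support :: "nat \<Rightarrow> nat \<Rightarrow> nat set" where
  "point_support m s = {t \<in> {1..m}. rm_points m ! s ! (t - 1) = 1}"

lemma bij_betw_point_support: "bij_betw (point_support m) {..<2 ^ m} (Pow {1..m})"
proof -
  define f where "f p = {t \<in> {1..m}. p ! (t - 1) = (1 :: bit)}" for p
  have "inj_on f {p. length p = m}"
  proof (rule inj_onI)
    fix p q
    assume "p \<in> {p. length p = m}" "q \<in> {p. length p = m}" and eq: "f p = f q"
    then have len: "length p = m" "length q = m" by simp_all
    show "p = q"
    proof (rule nth_equalityI)
      show "p ! t = q ! t" if "t < length p" for t
      proof -
        \<comment> \<open>Variables are numbered from 1 and list positions from 0.\<close>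
        have "Suc t \<in> f p \<longleftrightarrow> Suc t \<in> f q" using eq by simp
        then have "p ! t = 1 \<longleftrightarrow> q ! t = 1" using that len by (simp add: f_def)
        then show ?thesis by (cases "p ! t"; cases "q ! t") simp_all
      qed
    qed (use len in simp)
  qed
  moreover have "f ` {p. length p = m} = Pow {1..m}"
  proof (intro equalityI subsetI)
    fix P assume "P \<in> Pow {1..m}"
    then have sub: "P \<subseteq> {1..m}" by simp
    \<comment> \<open>The preimage of \<open>P\<close> is its characteristic vector.\<close>
    have "map (\<lambda>t. if Suc t \<in> P then 1 else 0) [0..<m] ! (t - 1) = (1 :: bit) \<longleftrightarrow> t \<in> P"
      if "t \<in> {1..m}" for t
      using that by (cases t) auto
    with sub have "f (map (\<lambda>t. if Suc t \<in> P then 1 else 0) [0..<m]) = P"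
      unfolding f_def by blast
    then show "P \<in> f ` {p. length p = m}"
      by (metis (mono_tags, lifting) image_eqI length_map length_upt mem_Collect_eq minus_nat.diff_0)
  qed (auto simp: f_def)
  ultimately have "bij_betw f (set (rm_points m)) (Pow {1..m})"
    by (simp add: bij_betw_def set_rm_points)
  moreover have "bij_betw ((!) (rm_points m)) {..<2 ^ m} (set (rm_points m))"
    using bij_betw_nth[OF distinct_rm_points] length_rm_points by metis
  ultimately have "bij_betw (f \<circ> (!) (rm_points m)) {..<2 ^ m} (Pow {1..m})"
    using bij_betw_trans by blast
  then show ?thesis by (simp add: comp_def f_def point_support_def[abs_def])
qed

lemma monomial_value_rm_points:
  assumes "set T \<subseteq> {1..m}"
  shows "monomial_value T (rm_points m ! s) = (if set T \<subseteq> point_support m s then 1 else 0)"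
  using assms by (auto simp: monomial_value_def point_support_def intro!: prod.neutral)

lemma rm_monomial_props:
  assumes "i < rm_dim r m"
  shows "set (rm_monomials r m ! i) \<subseteq> {1..m}"
    and "card (set (rm_monomials r m ! i)) = symbol_order r m i"
proof -
  have "rm_monomials r m ! i \<in> set (rm_monomials r m)"
    using assms by (simp add: length_rm_monomials)
  then show "set (rm_monomials r m ! i) \<subseteq> {1..m}"
    and "card (set (rm_monomials r m ! i)) = symbol_order r m i"
    by (auto simp: set_rm_monomials monomials_of_degree_def strict_sorted_iff distinct_card symbol_order_def)
qed

lemma rm_monomial_index_exists:
  assumes "S \<subseteq> {1..m}" "card S \<le> r"
  obtains k where "k < rm_dim r m" "set (rm_monomials r m ! k) = S"
proof -
  have "S \<in> set ` monomials_of_degree m (card S)"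
    using bij_betw_imp_surj_on[OF bij_betw_monomials_of_degree, of m "card S"] assms by auto
  then obtain T where "T \<in> set (rm_monomials r m)" "set T = S"
    using assms(2) by (auto simp: set_rm_monomials)
  then show ?thesis using that by (metis in_set_conv_nth length_rm_monomials)
qed

lemma set_rm_monomial_inject:
  assumes "i < rm_dim r m" "k < rm_dim r m"
    and "set (rm_monomials r m ! i) = set (rm_monomials r m ! k)"
  shows "i = k"
proof -
  have "sorted_wrt (<) (rm_monomials r m ! l)" if "l < rm_dim r m" for l
    using nth_mem[of l "rm_monomials r m"] that
    by (auto simp: length_rm_monomials set_rm_monomials monomials_of_degree_def)
  then have "rm_monomials r m ! i = rm_monomials r m ! k"
    using assms by (metis strict_sorted_equal)
  then show ?thesis
    using assms by (simp add: nth_eq_iff_index_eq distinct_rm_monomials length_rm_monomials)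
qed

section \<open>Parity conditions on recovery sets\<close>

lemma of_nat_bit_eq_1_iff: "(of_nat n :: bit) = 1 \<longleftrightarrow> odd n"
  by (induction n) auto

text \<open>Summing the row of the monomial \<open>S\<close> over \<open>R\<close> counts, modulo 2,
  the servers whose support contains \<open>S\<close>; this sum is the entry of the unit vector in
  that row.\<close>

lemma odd_degrees_recovery_set:
  assumes R: "R \<in> recovery_sets (rm_generator r m) i" and i: "i < rm_dim r m"
    and S: "card S \<le> r"
  shows "odd (card {P \<in> point_support m ` R. S \<subseteq> P}) \<longleftrightarrow> S = set (rm_monomials r m ! i)"
proof (cases "S \<subseteq> {1..m}")
  case True
  then obtain k where k: "k < rm_dim r m" "set (rm_monomials r m ! k) = S"
    using rm_monomial_index_exists S by blast
  have dims: "dim_row (rm_generator r m) = rm_dim r m" "dim_col (rm_generator r m) = 2 ^ m"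
    by (simp_all add: rm_generator_def)
  have sub: "R \<subseteq> {..<2 ^ m}" using R dims by (simp add: recovery_sets_def)
  then have fin: "finite R" using finite_subset by blast
  have inj: "inj_on (point_support m) R"
    using bij_betw_imp_inj_on[OF bij_betw_point_support] sub inj_on_subset by blast
  have "{P \<in> point_support m ` R. S \<subseteq> P} = point_support m ` {s \<in> R. S \<subseteq> point_support m s}" by auto
  moreover have "inj_on (point_support m) {s \<in> R. S \<subseteq> point_support m s}"
    using inj by (rule inj_on_subset) auto
  ultimately have card: "card {P \<in> point_support m ` R. S \<subseteq> P} = card {s \<in> R. S \<subseteq> point_support m s}"
    by (simp add: card_image)
  have "(\<Sum>s\<in>R. rm_generator r m $$ (k, s)) = (\<Sum>s\<in>R. if S \<subseteq> point_support m s then 1 else 0)"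
  proof (intro sum.cong refl)
    fix s assume "s \<in> R"
    then have "rm_generator r m $$ (k, s) = monomial_value (rm_monomials r m ! k) (rm_points m ! s)"
      using sub k(1) by (auto simp: rm_generator_def)
    then show "rm_generator r m $$ (k, s) = (if S \<subseteq> point_support m s then 1 else 0)"
      using monomial_value_rm_points[of "rm_monomials r m ! k" m s] k(2) True by simp
  qed
  also have "\<dots> = of_nat (card {s \<in> R. S \<subseteq> point_support m s})"
    using fin by (simp add: sum.inter_filter[symmetric])
  finally have "(of_nat (card {s \<in> R. S \<subseteq> point_support m s}) :: bit) = (if k = i then 1 else 0)"
    using sum_recovery_set[OF R] i k dims by metis
  then have "odd (card {P \<in> point_support m ` R. S \<subseteq> P}) \<longleftrightarrow> k = i"
    using of_nat_bit_eq_1_iff card by (metis zero_neq_one)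
  then show ?thesis using set_rm_monomial_inject[OF k(1) i] k(2) by auto
next
  case False
  \<comment> \<open>Such an \<open>S\<close> indexes no row, but it is contained in no support
    either. This also covers infinite \<open>S\<close>, whose \<open>card\<close> is 0.\<close>
  then have "{P \<in> point_support m ` R. S \<subseteq> P} = {}" by (auto simp: point_support_def)
  then show ?thesis using False rm_monomial_props(1)[OF i] by (metis card.empty even_zero)
qed

lemma recovery_set_support_cases:
  assumes R: "R \<in> recovery_sets (rm_generator r m) i" and i: "i < rm_dim r m"
  defines "F \<equiv> point_support m ` R" and "T \<equiv> set (rm_monomials r m ! i)"
  obtains "F = Pow T" | "2 ^ (r + 1) \<le> card (F - Pow T) + card (Pow T - F)"
proof -
  have "finite R"
    by (rule finite_subset[of _ "{..<dim_col (rm_generator r m)}"]) (use R in \<open>auto simp: recovery_sets_def\<close>)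
  then have fin: "finite F" "finite T" by (simp_all add: F_def T_def)
  have "card (sym_diff F (Pow T)) = card (F - Pow T) + card (Pow T - F)"
    using fin by (intro card_Un_disjoint) auto
  moreover have "odd (card {P \<in> F. S \<subseteq> P}) \<longleftrightarrow> S = T" if "card S \<le> r" for S
    unfolding F_def T_def using odd_degrees_recovery_set[OF R i that] .
  ultimately show ?thesis
    using card_sym_diff_Pow_ge[OF fin, of r] that by (cases "F = Pow T") simp_all
qed

section \<open>The dual weights and their total\<close>

theorem theorem2:
  fixes r m i j l1 l2 :: nat and rate :: "real vec"
  assumes "m \<ge> r + 1"
    and "i < rm_dim r m" and "j < rm_dim r m"
    and "symbol_order r m i = l1" and "symbol_order r m j = l2"
    and "l1 < l2" and "l2 \<le> r"
    and "rate \<in> service_rate_region (rm_generator r m)"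
  shows "rate $ i + rate $ j \<le> 1 + (2 ^ m - 2 ^ l2) / (2 ^ (r + 1) - 2 ^ l2)"
proof -
  note i = assms(2) and j = assms(3)
  define Ti Tj where "Ti = set (rm_monomials r m ! i)" and "Tj = set (rm_monomials r m ! j)"
  have Ti: "Ti \<subseteq> {1..m}" "card (Pow Ti) = 2 ^ l1" and Tj: "Tj \<subseteq> {1..m}" "card (Pow Tj) = 2 ^ l2"
    using rm_monomial_props[OF i] rm_monomial_props[OF j] assms(4,5)
    by (auto simp: Ti_def Tj_def card_Pow)
  have fin: "finite (Pow Ti)" "finite (Pow Tj)" by (simp_all add: Ti_def Tj_def)
  \<comment> \<open>Removing \<open>Z\<close> leaves \<open>2 ^ l1\<close> elements of
    \<open>Pow Tj\<close>, as many as \<open>Pow Ti\<close> has; \<open>Z\<close> avoids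
    \<open>Pow Ti\<close>, hence also the origin \<open>{}\<close>.\<close>
  have "2 ^ l2 - 2 ^ l1 \<le> card (Pow Tj - Pow Ti)"
    using diff_card_le_card_Diff[OF fin(1), of "Pow Tj"] Ti Tj by simp
  then obtain Z where Z: "Z \<subseteq> Pow Tj - Pow Ti" "card Z = 2 ^ l2 - 2 ^ l1"
    using obtain_subset_with_card_n by metis
  have finZ: "finite Z" using Z(1) fin finite_subset by blast
  have le12: "(2 :: nat) ^ l1 \<le> 2 ^ l2" using assms(6) by simp
  have le2r: "(2 :: nat) * 2 ^ l2 \<le> 2 ^ (r + 1)" using assms(7) by simp
  \<comment> \<open>A recovery set of \<open>j\<close> other than \<open>Pow Tj\<close> has at least
    \<open>2 ^ (r + 1) - 2 ^ l2\<close> servers outside \<open>Pow Tj\<close>. Since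
    \<open>l2 \<le> r\<close>, the subtraction is not truncated and
    \<open>D \<ge> 2 ^ l2\<close>.\<close>
  define D where "D = (2 :: nat) ^ (r + 1) - 2 ^ l2"
  have "(2 :: nat) ^ l2 > 0" by simp
  then have D: "D > 0" "2 ^ l1 \<le> D" "D + 2 ^ l2 = 2 ^ (r + 1)" using le12 le2r unfolding D_def by linarith+
  \<comment> \<open>Both \<open>Pow Ti\<close> and \<open>Pow Tj\<close> contain the origin and have
    exactly \<open>2 ^ l1\<close> elements outside \<open>Z\<close>; the extra weight at the origin
    raises both of their weights to exactly 1.\<close>
  define W where "W P = (if P = {} then 1 - 2 ^ l1 / real D else 0) + (if P \<in> Z then 0 else 1 / real D)"
    for P :: "nat set"
  have "real (2 ^ l1) \<le> real D" using D(2) by (simp only: of_nat_le_iff)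
  then have l1D: "2 ^ l1 / real D \<le> 1" using D(1) by simp
  then have W_nonneg: "0 \<le> W P" for P by (simp add: W_def)
  have sum_W: "sum W F = (if {} \<in> F then 1 - 2 ^ l1 / real D else 0) + card (F - Z) / real D"
    if "finite F" for F
  proof -
    have "(\<Sum>P\<in>F. if P \<in> Z then 0 else 1 / real D) = (\<Sum>P\<in>F - Z. 1 / real D)"
      using that by (intro sum.mono_neutral_cong_right) auto
    then show ?thesis using that by (simp add: W_def sum.distrib)
  qed
  \<comment> \<open>With \<open>D\<close> servers outside \<open>Z\<close>, the weights
    \<open>1 / D\<close> suffice even when the origin is absent.\<close>
  have W_ge: "1 \<le> sum W F" if "finite F" "D \<le> card (F - Z)" for F
  proof -
    have "1 \<le> card (F - Z) / real D" using that D by simp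
    then show ?thesis using sum_W[OF that(1)] l1D by auto
  qed
  have dims: "dim_row (rm_generator r m) = rm_dim r m" "dim_col (rm_generator r m) = 2 ^ m"
    by (simp_all add: rm_generator_def)
  have W_reindex: "(\<Sum>s\<in>R. W (point_support m s)) = sum W (point_support m ` R)"
    if "R \<subseteq> {..<2 ^ m}" for R
    using inj_on_subset[OF bij_betw_imp_inj_on[OF bij_betw_point_support] that]
    by (simp add: sum.reindex)
  have W_i: "1 \<le> (\<Sum>s\<in>R. W (point_support m s))" if R: "R \<in> recovery_sets (rm_generator r m) i" for R
  proof -
    define F where "F = point_support m ` R"
    have sub: "R \<subseteq> {..<2 ^ m}" using R dims by (simp add: recovery_sets_def)
    then have finF: "finite F" using finite_subset F_def by blast
    have "1 \<le> sum W F"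
      using R i
    proof (cases rule: recovery_set_support_cases)
      case 1
      have "Pow Ti - Z = Pow Ti" using Z by auto
      then have "sum W (Pow Ti) = 1" using sum_W[OF fin(1)] Ti D by simp
      then show ?thesis using 1 by (simp add: F_def Ti_def)
    next
      case 2
      \<comment> \<open>The distance bound gives \<open>card F \<ge> 2 ^ (r + 1) - 2 ^ l1\<close>.
        Deleting \<open>Z\<close>, of size \<open>2 ^ l2 - 2 ^ l1\<close>, leaves at least
        \<open>D\<close> servers.\<close>
      have "card F + card (Pow Ti) \<ge> card (F - Pow Ti) + card (Pow Ti - F)"
        using finF fin by (intro add_mono card_mono) auto
      moreover have "card F - card Z \<le> card (F - Z)" using finZ by (rule diff_card_le_card_Diff)
      ultimately have "D \<le> card (F - Z)"
        using 2 Z(2) Ti(2) le12 D unfolding F_def Ti_def by linarith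
      then show ?thesis using W_ge finF by blast
    qed
    then show ?thesis using W_reindex[OF sub] F_def by simp
  qed
  have W_j: "1 \<le> (\<Sum>s\<in>R. W (point_support m s))" if R: "R \<in> recovery_sets (rm_generator r m) j" for R
  proof -
    define F where "F = point_support m ` R"
    have sub: "R \<subseteq> {..<2 ^ m}" using R dims by (simp add: recovery_sets_def)
    then have finF: "finite F" using finite_subset F_def by blast
    have "1 \<le> sum W F"
      using R j
    proof (cases rule: recovery_set_support_cases)
      case 1
      have "card (Pow Tj - Z) = 2 ^ l1"
        using card_Diff_subset[OF finZ, of "Pow Tj"] Z Tj le12 by auto
      then have "sum W (Pow Tj) = 1" using sum_W[OF fin(2)] D by simp
      then show ?thesis using 1 by (simp add: F_def Tj_def)
    next
      case 2
      \<comment> \<open>At most \<open>2 ^ l2\<close> of the differences lie inside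
        \<open>Pow Tj\<close>, so at least \<open>D\<close> servers of \<open>F\<close> lie outside
        it and therefore outside \<open>Z\<close>.\<close>
      have "card (Pow Tj - F) \<le> card (Pow Tj)" using fin by (intro card_mono) auto
      moreover have "card (F - Pow Tj) \<le> card (F - Z)" using finF Z by (intro card_mono) auto
      ultimately have "D \<le> card (F - Z)"
        using 2 Tj(2) D unfolding F_def Tj_def by linarith
      then show ?thesis using W_ge finF by blast
    qed
    then show ?thesis using W_reindex[OF sub] F_def by simp
  qed
  have "i \<noteq> j" using assms by auto
  then have "rate $ i + rate $ j = (\<Sum>i\<in>{i, j}. rate $ i)" by simp
  also have "\<dots> \<le> (\<Sum>s<dim_col (rm_generator r m). W (point_support m s))"
    using i j W_i W_j W_nonneg dims by (intro service_rate_sum_le[OF assms(8)]) auto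
  also have "\<dots> = sum W (Pow {1..m})"
    using W_reindex bij_betw_imp_surj_on[OF bij_betw_point_support] dims by simp
  \<comment> \<open>All of \<open>Z\<close> lies in \<open>Pow {1..m}\<close>, so
    \<open>2 ^ m - card Z\<close> servers have weight \<open>1 / D\<close>. The contributions
    \<open>2 ^ l1 / D\<close> from the origin and from \<open>card Z\<close> cancel below.\<close>
  also have "\<dots> = 1 - 2 ^ l1 / real D + real (2 ^ m - (2 ^ l2 - 2 ^ l1)) / real D"
    using sum_W[of "Pow {1..m}"] card_Diff_subset[OF finZ, of "Pow {1..m}"] Z Tj by (auto simp: card_Pow)
  also have "real (2 ^ m - (2 ^ l2 - 2 ^ l1)) = 2 ^ m - 2 ^ l2 + 2 ^ l1"
  proof -
    have "(2 :: nat) ^ l2 \<le> 2 ^ m" using assms(1,7) by simp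
    then have "real (2 ^ m - (2 ^ l2 - 2 ^ l1)) = real (2 ^ m) - (real (2 ^ l2) - real (2 ^ l1))"
      using le12 by (subst of_nat_diff) (linarith, simp only: of_nat_diff)
    then show ?thesis by simp
  qed
  also have "1 - 2 ^ l1 / real D + (2 ^ m - 2 ^ l2 + 2 ^ l1) / real D = 1 + (2 ^ m - 2 ^ l2) / real D"
    by (simp add: add_divide_distrib)
  also have "real D = 2 ^ (r + 1) - 2 ^ l2"
    using arg_cong[OF D(3), of real] by (simp add: eq_diff_eq)
  finally show ?thesis .
qed

end
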